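(* Let $\mathcal{F}$ be the class of surjective homomorphisms in the category $\mathsf{Qnd}$ of quandles, and let $$\mathcal{E}=\{f\colon A\to B \mid f\in\mathcal{F} \text{ and } \mathrm{Eq}(f)\subset\ \sim_{\mathrm{Inn}(A)}\},\qquad \mathcal{M}=\{f\colon A\to B\mid f\in\mathcal{F}\text{ and }\mathrm{Eq}(f)\cap\sim_{\mathrm{Inn}(A)}\ =\Delta_A\}.$$ Then $(\mathcal{E},\mathcal{M})$ is a factorisation system for $\mathcal{F}$ in $\mathsf{Qnd}$.
   Context: A quandle is a set $A$ with two binary operations $\lhd,\lhd^{-1}$ such that for all $a,b,c\in A$: (A1) $a\lhd a=a=a\lhd^{-1}a$; (A2) $(a\lhd b)\lhd^{-1}b=a=(a\lhd^{-1}b)\lhd b$; (A3) $(a\lhd b)\lhd c=(a\lhd c)\lhd(b\lhd c)$ and $(a\lhd^{-1}b)\lhd^{-1}c=(a\lhd^{-1}c)\lhd^{-1}(b\lhd^{-1}c)$. $\mathsf{Qnd}$ is the category of quandles and quandle homomorphisms (maps preserving both operations). For $b\in A$, the map $\rho_b\colon A\to A$, $\rho_b(a)=a\lhd b$, is an automorphism of $A$; $\mathrm{Inn}(A)$ is the subgroup of the automorphism group of $A$ generated by all $\rho_b$, $b\in A$. Write $a\sim_{\mathrm{Inn}(A)}b$ when $a$ and $b$ lie in the same $\mathrm{Inn}(A)$-orbit. $\mathrm{Eq}(f)=\{(a,a')\in A\times A\mid f(a)=f(a')\}$ and $\Delta_A=\{(a,a)\mid a\in A\}$. A pair $(\mathcal{E},\mathcal{M})$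 of classes of maps in $\mathsf{Qnd}$ is a factorisation system for $\mathcal{F}$ if: (i) $\mathcal{E}$ and $\mathcal{M}$ contain the identities and are closed under composition with isomorphisms; (ii) every map in $\mathcal{F}$ can be written as $m\circ e$ with $m\in\mathcal{M}$ and $e\in\mathcal{E}$; (iii) for any commutative square $v\circ e=m\circ u$ in $\mathsf{Qnd}$ with $e\colon A\to B$ in $\mathcal{E}$, $m\colon C\to D$ in $\mathcal{M}$, $u\colon A\to C$ and $v\colon B\to D$, there is a unique arrow $w\colon B\to C$ such that $w\circ e=u$ and $m\circ w=v$. *)

theory Defs
  imports "HOL-Algebra.Bij" "HOL-Algebra.Generated_Groups" "HOL-Algebra.Group_Action"
begin

no_notation normal_rel (infixl \<open>\<lhd>\<close> 60)

record 'a quandle = "'a partial_object" +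
  qop :: "['a, 'a] \<Rightarrow> 'a"  (infixl \<open>\<lhd>\<index>\<close> 70)
  qinv :: "['a, 'a] \<Rightarrow> 'a"  (infixl \<open>\<lhd>\<^sup>-\<index>\<close> 70)

locale quandle =
  fixes A :: "'a quandle"  (structure)
  assumes qop_closed: "\<lbrakk>a \<in> carrier A; b \<in> carrier A\<rbrakk> \<Longrightarrow> a \<lhd> b \<in> carrier A"
    and qinv_closed: "\<lbrakk>a \<in> carrier A; b \<in> carrier A\<rbrakk> \<Longrightarrow> a \<lhd>\<^sup>- b \<in> carrier A"
    and qop_idem: "a \<in> carrier A \<Longrightarrow> a \<lhd> a = a"
    and qinv_idem: "a \<in> carrier A \<Longrightarrow> a \<lhd>\<^sup>- a = a"
    and qinv_qop: "\<lbrakk>a \<in> carrier A; b \<in> carrier A\<rbrakk> \<Longrightarrow> (a \<lhd> b) \<lhd>\<^sup>- b = a"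
    and qop_qinv: "\<lbrakk>a \<in> carrier A; b \<in> carrier A\<rbrakk> \<Longrightarrow> (a \<lhd>\<^sup>- b) \<lhd> b = a"
    and qop_distrib: "\<lbrakk>a \<in> carrier A; b \<in> carrier A; c \<in> carrier A\<rbrakk>
          \<Longrightarrow> (a \<lhd> b) \<lhd> c = (a \<lhd> c) \<lhd> (b \<lhd> c)"
    and qinv_distrib: "\<lbrakk>a \<in> carrier A; b \<in> carrier A; c \<in> carrier A\<rbrakk>
          \<Longrightarrow> (a \<lhd>\<^sup>- b) \<lhd>\<^sup>- c = (a \<lhd>\<^sup>- c) \<lhd>\<^sup>- (b \<lhd>\<^sup>- c)"

text \<open>The category of quandles. Its objects are the quandles whose carrier is a subset of the
  type \<^typ>\<open>'u\<close>, which plays the role of the universe; since \<^typ>\<open>'u\<close> is arbitrary, any quandles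
  living on different types can be considered over their sum type. Arrows are extensional
  functions, so that equality of functions is equality of arrows; composition of
  \<open>f : A \<rightarrow> B\<close> with \<open>g : B \<rightarrow> C\<close> is \<open>compose (carrier A) g f\<close>. The hom-set is empty unless both
  arguments are quandles, so an arrow always comes with its domain and codomain in the category.\<close>

definition qnd_hom :: "'u quandle \<Rightarrow> 'u quandle \<Rightarrow> ('u \<Rightarrow> 'u) set" where
  "qnd_hom A B = {f \<in> carrier A \<rightarrow>\<^sub>E carrier B. quandle A \<and> quandle B \<and>
     (\<forall>a\<in>carrier A. \<forall>b\<in>carrier A. f (a \<lhd>\<^bsub>A\<^esub> b) = f a \<lhd>\<^bsub>B\<^esub> f b \<and>
        f (a \<lhd>\<^sup>-\<^bsub>A\<^esub> b) = f a \<lhd>\<^sup>-\<^bsub>B\<^esub> f b)}"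

definition qnd_id :: "'u quandle \<Rightarrow> 'u \<Rightarrow> 'u" where
  "qnd_id A = (\<lambda>a\<in>carrier A. a)"

definition qnd_iso :: "'u quandle \<Rightarrow> 'u quandle \<Rightarrow> ('u \<Rightarrow> 'u) set" where
  "qnd_iso A B = {f \<in> qnd_hom A B. \<exists>g\<in>qnd_hom B A.
     compose (carrier A) g f = qnd_id A \<and> compose (carrier B) f g = qnd_id B}"

definition qnd_AutGroup :: "'u quandle \<Rightarrow> ('u \<Rightarrow> 'u) monoid" where
  "qnd_AutGroup A = BijGroup (carrier A) \<lparr>carrier := qnd_iso A A\<rparr>"

definition right_transl :: "'u quandle \<Rightarrow> 'u \<Rightarrow> 'u \<Rightarrow> 'u" (\<open>\<rho>\<index>\<close>) where
  "right_transl A b = (\<lambda>a\<in>carrier A. a \<lhd>\<^bsub>A\<^esub> b)"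

definition Inn :: "'u quandle \<Rightarrow> ('u \<Rightarrow> 'u) set" where
  "Inn A = generate (qnd_AutGroup A) (\<rho>\<^bsub>A\<^esub> ` carrier A)"

text \<open>The relation of lying in the same orbit of the evaluation action of \<open>Inn A\<close>.\<close>

definition inn_rel :: "'u quandle \<Rightarrow> 'u rel" (\<open>\<sim>\<^sub>I\<^sub>n\<^sub>n\<index>\<close>) where
  "inn_rel A = {(a, b) \<in> carrier A \<times> carrier A.
     b \<in> orbit (qnd_AutGroup A \<lparr>carrier := Inn A\<rparr>) (\<lambda>g. g) a}"

definition Eq :: "'u quandle \<Rightarrow> ('u \<Rightarrow> 'u) \<Rightarrow> 'u rel" where
  "Eq A f = {(a, a') \<in> carrier A \<times> carrier A. f a = f a'}"

text \<open>A class of maps is given by the set of its members in each hom-set.\<close>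

type_synonym 'u qnd_class = "'u quandle \<Rightarrow> 'u quandle \<Rightarrow> ('u \<Rightarrow> 'u) set"

definition is_qnd_class :: "'u qnd_class \<Rightarrow> bool" where
  "is_qnd_class X \<longleftrightarrow> (\<forall>A B. X A B \<subseteq> qnd_hom A B)"

definition contains_identities :: "'u qnd_class \<Rightarrow> bool" where
  "contains_identities X \<longleftrightarrow> (\<forall>A. quandle A \<longrightarrow> qnd_id A \<in> X A A)"

definition closed_under_isos :: "'u qnd_class \<Rightarrow> bool" where
  "closed_under_isos X \<longleftrightarrow>
     (\<forall>A B. \<forall>f \<in> X A B.
        (\<forall>A'. \<forall>i \<in> qnd_iso A' A. compose (carrier A') f i \<in> X A' B) \<and>
        (\<forall>B'. \<forall>j \<in> qnd_iso B B'. compose (carrier A) j f \<in> X A B'))"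

definition factorisation_system :: "'u qnd_class \<Rightarrow> 'u qnd_class \<Rightarrow> 'u qnd_class \<Rightarrow> bool" where
  "factorisation_system \<F> \<E> \<M> \<longleftrightarrow>
     is_qnd_class \<F> \<and> is_qnd_class \<E> \<and> is_qnd_class \<M> \<and>
     contains_identities \<E> \<and> contains_identities \<M> \<and>
     closed_under_isos \<E> \<and> closed_under_isos \<M> \<and>
     (\<forall>A B. \<forall>f \<in> \<F> A B. \<exists>C. \<exists>e \<in> \<E> A C. \<exists>m \<in> \<M> C B. f = compose (carrier A) m e) \<and>
     (\<forall>A B C D. \<forall>e \<in> \<E> A B. \<forall>m \<in> \<M> C D. \<forall>u \<in> qnd_hom A C. \<forall>v \<in> qnd_hom B D.
        compose (carrier A) v e = compose (carrier A) m u \<longrightarrow>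
        (\<exists>!w. w \<in> qnd_hom B C \<and> compose (carrier A) w e = u \<and> compose (carrier B) m w = v))"

end

theory Submission
  imports Defs
begin

text \<open>
  Everything rests on one description of the orbit relation \<open>\<sim>\<close>: it is the least equivalence
  relation that relates every \<open>a\<close> to every \<open>a \<lhd> b\<close>. Hence homomorphisms preserve it, and it is
  a congruence. A surjection \<open>f\<close> factors through the quotient of its domain by the congruence
  \<open>Eq f \<inter> \<sim>\<close>; the second factor lies in \<open>\<M>\<close> because every step \<open>x \<mapsto> x \<lhd> y\<close> in the quotient lifts
  to a step upstairs. For the diagonal of a square \<open>v \<circ> e = m \<circ> u\<close> one only needs
  \<open>Eq e \<subseteq> Eq u\<close>: elements identified by \<open>e\<close> lie in one orbit, so their images under \<open>u\<close> do as well,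
  and these images are identified by \<open>m\<close>.
\<close>

section \<open>Quandle homomorphisms\<close>

context quandle
begin

lemma qinv_eqI:
  assumes "a \<in> carrier A" "b \<in> carrier A" "a \<lhd> b = c"
  shows "c \<lhd>\<^sup>- b = a"
  using assms qinv_qop by blast

end

lemma qnd_homD:
  assumes "f \<in> qnd_hom A B"
  shows "quandle A" "quandle B" "f \<in> extensional (carrier A)"
    and "\<And>a. a \<in> carrier A \<Longrightarrow> f a \<in> carrier B"
    and "\<And>a b. \<lbrakk>a \<in> carrier A; b \<in> carrier A\<rbrakk> \<Longrightarrow> f (a \<lhd>\<^bsub>A\<^esub> b) = f a \<lhd>\<^bsub>B\<^esub> f b"
    and "\<And>a b. \<lbrakk>a \<in> carrier A; b \<in> carrier A\<rbrakk> \<Longrightarrow> f (a \<lhd>\<^sup>-\<^bsub>A\<^esub> b) = f a \<lhd>\<^sup>-\<^bsub>B\<^esub> f b"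
  using assms by (auto simp: qnd_hom_def PiE_def)

text \<open>Preserving \<open>\<lhd>\<close> is enough: \<open>f (a \<lhd>\<^sup>- b)\<close> solves
  the equation \<open>x \<lhd> f b = f a\<close>, whose only solution is
  \<open>f a \<lhd>\<^sup>- f b\<close>.\<close>

lemma qnd_homI:
  assumes "quandle A" "quandle B" "f \<in> carrier A \<rightarrow>\<^sub>E carrier B"
    and "\<And>a b. \<lbrakk>a \<in> carrier A; b \<in> carrier A\<rbrakk> \<Longrightarrow> f (a \<lhd>\<^bsub>A\<^esub> b) = f a \<lhd>\<^bsub>B\<^esub> f b"
  shows "f \<in> qnd_hom A B"
proof -
  have "f (a \<lhd>\<^sup>-\<^bsub>A\<^esub> b) = f a \<lhd>\<^sup>-\<^bsub>B\<^esub> f b" if "a \<in> carrier A" "b \<in> carrier A" for a b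
  proof -
    have "f (a \<lhd>\<^sup>-\<^bsub>A\<^esub> b) \<lhd>\<^bsub>B\<^esub> f b = f a"
      using that assms(4)[of "a \<lhd>\<^sup>-\<^bsub>A\<^esub> b" b] quandle.qop_qinv[OF assms(1)]
        quandle.qinv_closed[OF assms(1)] by simp
    moreover have "f (a \<lhd>\<^sup>-\<^bsub>A\<^esub> b) \<in> carrier B" "f b \<in> carrier B"
      using that assms(3) quandle.qinv_closed[OF assms(1)] by auto
    ultimately show ?thesis
      using quandle.qinv_eqI[OF assms(2)] by simp
  qed
  then show ?thesis
    using assms by (auto simp: qnd_hom_def)
qed

lemma qnd_id_hom: "quandle A \<Longrightarrow> qnd_id A \<in> qnd_hom A A"
  by (rule qnd_homI) (auto simp: qnd_id_def quandle.qop_closed)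

lemma compose_qnd_hom:
  assumes "f \<in> qnd_hom A B" "g \<in> qnd_hom B C"
  shows "compose (carrier A) g f \<in> qnd_hom A C"
  using qnd_homD[OF assms(1)] qnd_homD[OF assms(2)]
  by (intro qnd_homI) (auto simp: compose_def quandle.qop_closed)

lemma qnd_hom_inv_into:
  assumes f: "f \<in> qnd_hom A B" and bij: "bij_betw f (carrier A) (carrier B)"
  shows "(\<lambda>b\<in>carrier B. inv_into (carrier A) f b) \<in> qnd_hom B A"
proof -
  note fD = qnd_homD[OF f]
  have inv: "inv_into (carrier A) f b \<in> carrier A" "f (inv_into (carrier A) f b) = b"
    if "b \<in> carrier B" for b
    using that bij by (auto simp: bij_betw_def inv_into_into f_inv_into_f)
  have eq: "inv_into (carrier A) f b = a" if "a \<in> carrier A" "f a = b" for a b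
    using that bij by (auto simp: bij_betw_def)
  have "inv_into (carrier A) f (b \<lhd>\<^bsub>B\<^esub> b')
      = inv_into (carrier A) f b \<lhd>\<^bsub>A\<^esub> inv_into (carrier A) f b'"
    if "b \<in> carrier B" "b' \<in> carrier B" for b b'
    using that by (intro eq) (simp_all add: inv fD quandle.qop_closed)
  then show ?thesis
    using fD by (intro qnd_homI) (auto simp: inv quandle.qop_closed)
qed

text \<open>Replaces invertibility in the category by bijectivity, which can be checked pointwise;
  the set-theoretic inverse of a bijective homomorphism is again a homomorphism.\<close>

lemma qnd_iso_iff: "f \<in> qnd_iso A B \<longleftrightarrow> f \<in> qnd_hom A B \<and> bij_betw f (carrier A) (carrier B)"
proof
  assume "f \<in> qnd_iso A B"
  then obtain g where f: "f \<in> qnd_hom A B" and g: "g \<in> qnd_hom B A"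
    and gf: "compose (carrier A) g f = qnd_id A" and fg: "compose (carrier B) f g = qnd_id B"
    by (auto simp: qnd_iso_def)
  have "g (f a) = a" if "a \<in> carrier A" for a
    using fun_cong[OF gf, of a] that by (simp add: compose_def qnd_id_def)
  moreover have "f (g b) = b" if "b \<in> carrier B" for b
    using fun_cong[OF fg, of b] that by (simp add: compose_def qnd_id_def)
  ultimately have "bij_betw f (carrier A) (carrier B)"
    using qnd_homD(4)[OF f] qnd_homD(4)[OF g] by (intro bij_betw_byWitness[where f' = g]) auto
  with f show "f \<in> qnd_hom A B \<and> bij_betw f (carrier A) (carrier B)" by blast
next
  assume f: "f \<in> qnd_hom A B \<and> bij_betw f (carrier A) (carrier B)"
  let ?g = "\<lambda>b\<in>carrier B. inv_into (carrier A) f b"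
  have "compose (carrier A) ?g f = qnd_id A" "compose (carrier B) f ?g = qnd_id B"
    using f by (simp_all add: qnd_id_def compose_inv_into_id compose_id_inv_into bij_betw_def)
  then show "f \<in> qnd_iso A B"
    using f qnd_hom_inv_into unfolding qnd_iso_def by blast
qed

lemma qnd_id_iso: "quandle A \<Longrightarrow> qnd_id A \<in> qnd_iso A A"
  using qnd_id_hom by (auto simp: qnd_iso_iff qnd_id_def bij_betw_def inj_on_def)

section \<open>Quotients and factoring through surjections\<close>

lemma quandle_hom_image:
  assumes "quandle A" and surj: "p ` carrier A = carrier Q"
    and hom: "\<And>a b. \<lbrakk>a \<in> carrier A; b \<in> carrier A\<rbrakk> \<Longrightarrow> p a \<lhd>\<^bsub>Q\<^esub> p b = p (a \<lhd>\<^bsub>A\<^esub> b)"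
      "\<And>a b. \<lbrakk>a \<in> carrier A; b \<in> carrier A\<rbrakk> \<Longrightarrow> p a \<lhd>\<^sup>-\<^bsub>Q\<^esub> p b = p (a \<lhd>\<^sup>-\<^bsub>A\<^esub> b)"
  shows "quandle Q"
proof -
  interpret A: quandle A by fact
  note closed = A.qop_closed A.qinv_closed
  show ?thesis
    \<comment> \<open>The axioms are equations, so they pass to \<open>Q\<close> once its elements
      are written as values of \<open>p\<close>. Distributivity is applied from right to left, since
      from left to right it rewrites its own result again.\<close>
    by unfold_locales
      (auto simp: surj[symmetric] hom closed A.qop_idem A.qinv_idem A.qinv_qop A.qop_qinv
        simp flip: A.qop_distrib A.qinv_distrib)
qed

text \<open>Universal property of a surjection as the quotient by its kernel: \<open>w\<close> sends
  \<open>b\<close> to the value of \<open>u\<close> at a chosen preimage, and the inclusion of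
  kernels makes the choice irrelevant.\<close>

lemma qnd_hom_factor:
  assumes e: "e \<in> qnd_hom A B" and surj: "e ` carrier A = carrier B"
    and u: "u \<in> qnd_hom A C" and le: "Eq A e \<subseteq> Eq A u"
  shows "\<exists>w \<in> qnd_hom B C. \<forall>a\<in>carrier A. w (e a) = u a"
proof -
  note eD = qnd_homD[OF e] and uD = qnd_homD[OF u]
  define w where "w = (\<lambda>b\<in>carrier B. u (inv_into (carrier A) e b))"
  have w: "w (e a) = u a" if "a \<in> carrier A" for a
  proof -
    have "(inv_into (carrier A) e (e a), a) \<in> Eq A e"
      using that by (auto simp: Eq_def inv_into_into f_inv_into_f)
    with le show ?thesis
      using that eD by (auto simp: w_def Eq_def)
  qed
  have "w b \<in> carrier C" if "b \<in> carrier B" for b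
  proof -
    obtain a where "a \<in> carrier A" "b = e a"
      using \<open>b \<in> carrier B\<close> unfolding surj[symmetric] by blast
    then show ?thesis by (simp add: w uD(4))
  qed
  moreover have "w (b \<lhd>\<^bsub>B\<^esub> b') = w b \<lhd>\<^bsub>C\<^esub> w b'" if bb': "b \<in> carrier B" "b' \<in> carrier B" for b b'
  proof -
    obtain a a' where aa': "a \<in> carrier A" "a' \<in> carrier A" "b = e a" "b' = e a'"
      using bb' unfolding surj[symmetric] by blast
    then have "w (b \<lhd>\<^bsub>B\<^esub> b') = w (e (a \<lhd>\<^bsub>A\<^esub> a'))" by (simp add: eD(5))
    also have "\<dots> = u (a \<lhd>\<^bsub>A\<^esub> a')"
      using aa' by (intro w quandle.qop_closed[OF eD(1)])
    also have "\<dots> = w b \<lhd>\<^bsub>C\<^esub> w b'"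
      using aa' by (simp add: w uD(5))
    finally show ?thesis .
  qed
  ultimately have "w \<in> qnd_hom B C"
    using eD uD by (intro qnd_homI) (auto simp: w_def)
  with w show ?thesis by blast
qed

section \<open>Orbits of inner automorphisms\<close>

text \<open>Self-distributivity says precisely that a right translation is a homomorphism; its
  inverse is given by \<open>\<lhd>\<^sup>-\<close>.\<close>

lemma right_transl_iso:
  assumes "quandle A" "b \<in> carrier A"
  shows "\<rho>\<^bsub>A\<^esub> b \<in> qnd_iso A A"
proof -
  interpret A: quandle A by fact
  have "\<rho>\<^bsub>A\<^esub> b \<in> qnd_hom A A"
    using assms
    by (intro qnd_homI) (auto simp: right_transl_def A.qop_closed intro: A.qop_distrib)
  moreover have "bij_betw (\<rho>\<^bsub>A\<^esub> b) (carrier A) (carrier A)"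
    using assms(2)
    by (intro bij_betw_byWitness[where f' = "\<lambda>a. a \<lhd>\<^sup>-\<^bsub>A\<^esub> b"])
      (auto simp: right_transl_def A.qop_closed A.qinv_closed A.qinv_qop A.qop_qinv)
  ultimately show ?thesis by (simp add: qnd_iso_iff)
qed

text \<open>\<open>qnd_AutGroup A\<close> is \<open>BijGroup (carrier A)\<close> with a smaller
  carrier, so this is what makes it a group.\<close>

lemma qnd_iso_subgroup:
  assumes "quandle A"
  shows "subgroup (qnd_iso A A) (BijGroup (carrier A))"
proof -
  interpret group "BijGroup (carrier A)" by (rule group_BijGroup)
  have Bij: "qnd_iso A A \<subseteq> Bij (carrier A)"
    by (auto simp: qnd_iso_iff Bij_def qnd_homD)
  show ?thesis
  proof (rule subgroupI)
    show "qnd_iso A A \<subseteq> carrier (BijGroup (carrier A))"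
      using Bij by (simp add: BijGroup_def)
    show "qnd_iso A A \<noteq> {}"
      using qnd_id_iso[OF assms] by blast
  next
    fix f assume f: "f \<in> qnd_iso A A"
    let ?g = "\<lambda>a\<in>carrier A. inv_into (carrier A) f a"
    have g: "?g \<in> Bij (carrier A)" "?g \<in> qnd_hom A A"
      using f Bij qnd_hom_inv_into by (auto simp: qnd_iso_iff intro!: restrict_inv_into_Bij)
    \<comment> \<open>Inverses in a group are unique, so the abstract inverse is the restricted
      \<open>inv_into\<close>, which is known to be a homomorphism.\<close>
    have "inv\<^bsub>BijGroup (carrier A)\<^esub> f = ?g"
      using f g(1) Bij
      by (intro inv_equality) (auto simp: BijGroup_def Bij_compose_restrict_eq)
    with g show "inv\<^bsub>BijGroup (carrier A)\<^esub> f \<in> qnd_iso A A"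
      by (simp add: qnd_iso_iff Bij_def)
  next
    fix f g assume "f \<in> qnd_iso A A" "g \<in> qnd_iso A A"
    then show "f \<otimes>\<^bsub>BijGroup (carrier A)\<^esub> g \<in> qnd_iso A A"
      using Bij by (auto simp: BijGroup_def qnd_iso_iff compose_qnd_hom intro: bij_betw_compose)
  qed
qed

lemma Inn_subgroup:
  assumes "quandle A"
  shows "subgroup (Inn A) (BijGroup (carrier A))"
proof -
  interpret group "BijGroup (carrier A)" by (rule group_BijGroup)
  have "subgroup (Inn A) (qnd_AutGroup A)"
    unfolding Inn_def qnd_AutGroup_def using assms qnd_iso_subgroup right_transl_iso
    by (intro group.generate_is_subgroup subgroup_imp_group) auto
  then show ?thesis
    using incl_subgroup qnd_iso_subgroup[OF assms] by (simp add: qnd_AutGroup_def)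
qed

text \<open>The evaluation action is the inclusion of a subgroup into the group of bijections. It
  makes the general facts on orbits available, in particular that they form a partition.\<close>

lemma Inn_group_action:
  assumes "quandle A"
  shows "group_action (qnd_AutGroup A\<lparr>carrier := Inn A\<rparr>) (carrier A) (\<lambda>g. g)"
  using group.canonical_inj_is_hom[OF group_BijGroup Inn_subgroup[OF assms]]
  by (simp add: group_action_def qnd_AutGroup_def id_def)

lemma inn_rel_iff: "(a, b) \<in> \<sim>\<^sub>I\<^sub>n\<^sub>n\<^bsub>A\<^esub> \<longleftrightarrow> a \<in> carrier A \<and> b \<in> carrier A \<and> (\<exists>g\<in>Inn A. b = g a)"
  by (auto simp: inn_rel_def orbit_def)

lemma inn_rel_equiv:
  assumes "quandle A"
  shows "equiv (carrier A) \<sim>\<^sub>I\<^sub>n\<^sub>n\<^bsub>A\<^esub>"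
proof -
  interpret group_action "qnd_AutGroup A\<lparr>carrier := Inn A\<rparr>" "carrier A" "\<lambda>g. g"
    by (rule Inn_group_action[OF assms])
  show ?thesis
  proof (intro equivI refl_onI symI transI)
    show "\<sim>\<^sub>I\<^sub>n\<^sub>n\<^bsub>A\<^esub> \<subseteq> carrier A \<times> carrier A"
      by (auto simp: inn_rel_def)
  next
    fix a assume "a \<in> carrier A"
    then show "(a, a) \<in> \<sim>\<^sub>I\<^sub>n\<^sub>n\<^bsub>A\<^esub>"
      using orbit_refl[of a] unfolding inn_rel_def by blast
  next
    fix a b assume "(a, b) \<in> \<sim>\<^sub>I\<^sub>n\<^sub>n\<^bsub>A\<^esub>"
    then show "(b, a) \<in> \<sim>\<^sub>I\<^sub>n\<^sub>n\<^bsub>A\<^esub>"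
      using orbit_sym[of a b] unfolding inn_rel_def by blast
  next
    fix a b c assume "(a, b) \<in> \<sim>\<^sub>I\<^sub>n\<^sub>n\<^bsub>A\<^esub>" "(b, c) \<in> \<sim>\<^sub>I\<^sub>n\<^sub>n\<^bsub>A\<^esub>"
    then show "(a, c) \<in> \<sim>\<^sub>I\<^sub>n\<^sub>n\<^bsub>A\<^esub>"
      using orbit_trans[of a b c] unfolding inn_rel_def by blast
  qed
qed

lemma inn_rel_sym: "\<lbrakk>quandle A; (a, b) \<in> \<sim>\<^sub>I\<^sub>n\<^sub>n\<^bsub>A\<^esub>\<rbrakk> \<Longrightarrow> (b, a) \<in> \<sim>\<^sub>I\<^sub>n\<^sub>n\<^bsub>A\<^esub>"
  using inn_rel_equiv[of A] unfolding equiv_def sym_def by blast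

lemma inn_rel_trans:
  "\<lbrakk>quandle A; (a, b) \<in> \<sim>\<^sub>I\<^sub>n\<^sub>n\<^bsub>A\<^esub>; (b, c) \<in> \<sim>\<^sub>I\<^sub>n\<^sub>n\<^bsub>A\<^esub>\<rbrakk> \<Longrightarrow> (a, c) \<in> \<sim>\<^sub>I\<^sub>n\<^sub>n\<^bsub>A\<^esub>"
  using inn_rel_equiv[of A] unfolding equiv_def trans_def by blast

lemma inn_rel_refl: "\<lbrakk>quandle A; a \<in> carrier A\<rbrakk> \<Longrightarrow> (a, a) \<in> \<sim>\<^sub>I\<^sub>n\<^sub>n\<^bsub>A\<^esub>"
  using inn_rel_equiv[of A] unfolding equiv_def refl_on_def by blast

section \<open>The orbit relation as the least equivalence containing all right translations\<close>

lemma inn_rel_qop: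
  assumes "quandle A" "a \<in> carrier A" "b \<in> carrier A"
  shows "(a, a \<lhd>\<^bsub>A\<^esub> b) \<in> \<sim>\<^sub>I\<^sub>n\<^sub>n\<^bsub>A\<^esub>"
proof -
  have "\<rho>\<^bsub>A\<^esub> b \<in> Inn A" using assms by (auto simp: Inn_def intro: generate.incl)
  moreover have "a \<lhd>\<^bsub>A\<^esub> b = \<rho>\<^bsub>A\<^esub> b a" using assms by (simp add: right_transl_def)
  ultimately show ?thesis
    using assms quandle.qop_closed unfolding inn_rel_iff by metis
qed

lemma inn_rel_qinv:
  assumes "quandle A" "a \<in> carrier A" "b \<in> carrier A"
  shows "(a, a \<lhd>\<^sup>-\<^bsub>A\<^esub> b) \<in> \<sim>\<^sub>I\<^sub>n\<^sub>n\<^bsub>A\<^esub>"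
proof (rule inn_rel_sym[OF assms(1)])
  show "(a \<lhd>\<^sup>-\<^bsub>A\<^esub> b, a) \<in> \<sim>\<^sub>I\<^sub>n\<^sub>n\<^bsub>A\<^esub>"
    using inn_rel_qop[of A "a \<lhd>\<^sup>-\<^bsub>A\<^esub> b" b] assms
    by (simp add: quandle.qinv_closed quandle.qop_qinv)
qed

text \<open>Acting from the right never leaves an orbit, so \<open>a \<lhd> b\<close> is linked to
  \<open>a\<close>, then to \<open>a'\<close>, then to \<open>a' \<lhd> b'\<close>, for arbitrary
  \<open>b\<close> and \<open>b'\<close>; likewise for \<open>\<lhd>\<^sup>-\<close>.\<close>

lemma inn_rel_op_cong:
  assumes "quandle A" "(a, a') \<in> \<sim>\<^sub>I\<^sub>n\<^sub>n\<^bsub>A\<^esub>" "b \<in> carrier A" "b' \<in> carrier A"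
  shows "(a \<lhd>\<^bsub>A\<^esub> b, a' \<lhd>\<^bsub>A\<^esub> b') \<in> \<sim>\<^sub>I\<^sub>n\<^sub>n\<^bsub>A\<^esub>"
    and "(a \<lhd>\<^sup>-\<^bsub>A\<^esub> b, a' \<lhd>\<^sup>-\<^bsub>A\<^esub> b') \<in> \<sim>\<^sub>I\<^sub>n\<^sub>n\<^bsub>A\<^esub>"
proof -
  have a: "a \<in> carrier A" "a' \<in> carrier A" using assms(2) by (auto simp: inn_rel_iff)
  note sym = inn_rel_sym[OF assms(1)] and trans = inn_rel_trans[OF assms(1)]
  show "(a \<lhd>\<^bsub>A\<^esub> b, a' \<lhd>\<^bsub>A\<^esub> b') \<in> \<sim>\<^sub>I\<^sub>n\<^sub>n\<^bsub>A\<^esub>"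
    by (rule trans[OF sym trans[OF assms(2)]]) (simp_all add: inn_rel_qop assms a)
  show "(a \<lhd>\<^sup>-\<^bsub>A\<^esub> b, a' \<lhd>\<^sup>-\<^bsub>A\<^esub> b') \<in> \<sim>\<^sub>I\<^sub>n\<^sub>n\<^bsub>A\<^esub>"
    by (rule trans[OF sym trans[OF assms(2)]]) (simp_all add: inn_rel_qinv assms a)
qed

text \<open>Induction on the generation of \<open>Inn A\<close> shows that each of its elements
  moves every point within its \<open>S\<close>-class. The claim ranges over all points because a
  product \<open>h \<otimes> k\<close> uses the hypothesis on \<open>h\<close> at the point
  \<open>k a\<close>.\<close>

lemma inn_rel_least:
  assumes A: "quandle A" and S: "equiv (carrier A) S"
    and step: "\<And>a b. \<lbrakk>a \<in> carrier A; b \<in> carrier A\<rbrakk> \<Longrightarrow> (a, a \<lhd>\<^bsub>A\<^esub> b) \<in> S"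
  shows "\<sim>\<^sub>I\<^sub>n\<^sub>n\<^bsub>A\<^esub> \<subseteq> S"
proof -
  interpret group_action "qnd_AutGroup A\<lparr>carrier := Inn A\<rparr>" "carrier A" "\<lambda>g. g"
    by (rule Inn_group_action[OF A])
  interpret Aut: group "qnd_AutGroup A"
    unfolding qnd_AutGroup_def
    by (rule group.subgroup_imp_group[OF group_BijGroup qnd_iso_subgroup[OF A]])
  have sub: "subgroup (Inn A) (qnd_AutGroup A)"
    unfolding Inn_def using right_transl_iso[OF A]
    by (intro Aut.generate_is_subgroup) (auto simp: qnd_AutGroup_def)
  have S_rules: "S \<subseteq> carrier A \<times> carrier A" "refl_on (carrier A) S" "sym S" "trans S"
    using S by (auto elim: equivE)
  have "\<forall>a\<in>carrier A. (a, g a) \<in> S" if "g \<in> Inn A" for g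
    using that unfolding Inn_def
  proof (induction rule: generate.induct)
    case one
    then show ?case
      using S_rules by (auto simp: qnd_AutGroup_def BijGroup_def dest: refl_onD)
  next
    case (incl h)
    then show ?case by (auto simp: right_transl_def step)
  next
    case (inv h)
    show ?case
    proof
      fix a assume a: "a \<in> carrier A"
      have h: "h \<in> Inn A" using inv by (auto simp: Inn_def intro: generate.incl)
      \<comment> \<open>The generator \<open>h\<close> leads from \<open>?k a\<close> to
        \<open>a\<close> in a single step, and symmetry of \<open>S\<close> reverses it.\<close>
      let ?k = "inv\<^bsub>qnd_AutGroup A\<^esub> h"
      have k: "?k \<in> Inn A" using inv by (auto simp: Inn_def intro: generate.inv)
      have ka: "?k a \<in> carrier A" using element_image[of ?k a] k a by simp
      have "h (?k a) = (h \<otimes>\<^bsub>qnd_AutGroup A\<^esub> ?k) a"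
        using composition_rule[of a h ?k] h k a by simp
      also have "\<dots> = \<one>\<^bsub>qnd_AutGroup A\<^esub> a"
        by (simp only: Aut.r_inv[OF subgroup.mem_carrier[OF sub h]])
      also have "\<dots> = a"
        using a by (simp add: qnd_AutGroup_def BijGroup_def)
      finally have "h (?k a) = a" .
      moreover obtain b where "b \<in> carrier A" "h = \<rho>\<^bsub>A\<^esub> b" using inv by blast
      ultimately have "(?k a, a) \<in> S"
        using step[of "?k a" b] ka by (simp add: right_transl_def)
      then show "(a, ?k a) \<in> S" using S_rules(3) by (simp add: symD)
    qed
  next
    case (eng h k)
    show ?case
    proof
      fix a assume a: "a \<in> carrier A"
      have "(h \<otimes>\<^bsub>qnd_AutGroup A\<^esub> k) a = h (k a)"
        using composition_rule[of a h k] eng a by (simp add: Inn_def)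
      \<comment> \<open>The induction hypothesis puts \<open>(a, k a)\<close> in \<open>S\<close>,
        which relates only elements of the carrier.\<close>
      moreover have "k a \<in> carrier A" using eng a S_rules(1) by auto
      ultimately show "(a, (h \<otimes>\<^bsub>qnd_AutGroup A\<^esub> k) a) \<in> S"
        using eng a S_rules(4) by (metis transD)
    qed
  qed
  then show ?thesis by (auto simp: inn_rel_iff)
qed

text \<open>The orbit relation of \<open>B\<close>, pulled back along \<open>f\<close>, is an
  equivalence containing every pair of \<open>a\<close> and \<open>a \<lhd> b\<close>, since
  \<open>f\<close> sends it to \<open>f a\<close> and \<open>f a \<lhd> f b\<close>. Minimality then
  applies, and no inner automorphism has to be transported.\<close>

lemma qnd_hom_inn_rel:
  assumes f: "f \<in> qnd_hom A B" and ab: "(a, b) \<in> \<sim>\<^sub>I\<^sub>n\<^sub>n\<^bsub>A\<^esub>"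
  shows "(f a, f b) \<in> \<sim>\<^sub>I\<^sub>n\<^sub>n\<^bsub>B\<^esub>"
proof -
  note fD = qnd_homD[OF f]
  let ?S = "{(a, b) \<in> carrier A \<times> carrier A. (f a, f b) \<in> \<sim>\<^sub>I\<^sub>n\<^sub>n\<^bsub>B\<^esub>}"
  have "\<sim>\<^sub>I\<^sub>n\<^sub>n\<^bsub>A\<^esub> \<subseteq> ?S"
  proof (rule inn_rel_least)
    show "equiv (carrier A) ?S"
      using fD by (intro equivI refl_onI symI transI)
        (auto intro: inn_rel_refl inn_rel_sym inn_rel_trans)
  qed (use fD in \<open>auto simp: quandle.qop_closed inn_rel_qop\<close>)
  with ab show ?thesis by auto
qed

section \<open>Factorisation and orthogonality\<close>

text \<open>Objects of the category live on the type \<open>'u\<close>, so the quotient by \<open>Eq A f \<inter> \<sim>\<close> is carried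
  by a set of representatives.\<close>

lemma inn_factorisation:
  assumes f: "f \<in> qnd_hom A B" and surj: "f ` carrier A = carrier B"
  shows "\<exists>Q. \<exists>e \<in> qnd_hom A Q. \<exists>m \<in> qnd_hom Q B.
    e ` carrier A = carrier Q \<and> Eq A e \<subseteq> \<sim>\<^sub>I\<^sub>n\<^sub>n\<^bsub>A\<^esub> \<and>
    m ` carrier Q = carrier B \<and> Eq Q m \<inter> \<sim>\<^sub>I\<^sub>n\<^sub>n\<^bsub>Q\<^esub> = Id_on (carrier Q) \<and>
    f = compose (carrier A) m e"
proof -
  note fD = qnd_homD[OF f]
  interpret A: quandle A by (rule fD(1))
  note rel = inn_rel_refl[OF fD(1)] inn_rel_sym[OF fD(1)] inn_rel_trans[OF fD(1)]
  define \<theta> where "\<theta> = Eq A f \<inter> \<sim>\<^sub>I\<^sub>n\<^sub>n\<^bsub>A\<^esub>"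
  \<comment> \<open>The choice depends only on the \<open>\<theta>\<close>-class of
    \<open>a\<close>: related elements give equivalent predicates and hence the same
    representative.\<close>
  define p where "p a = (SOME a'. (a, a') \<in> \<theta>)" for a
  have \<theta>: "equiv (carrier A) \<theta>"
    unfolding \<theta>_def by (intro equivI refl_onI symI transI) (auto simp: Eq_def intro: rel)
  have p: "(a, p a) \<in> \<theta>" if "a \<in> carrier A" for a
  proof -
    have "(a, a) \<in> \<theta>" using that \<theta> unfolding equiv_def refl_on_def by blast
    then show ?thesis unfolding p_def by (rule someI)
  qed
  have p_eq: "p a = p a'" if "(a, a') \<in> \<theta>" for a a'
  proof -
    have "(a, x) \<in> \<theta> \<longleftrightarrow> (a', x) \<in> \<theta>" for x
      using that \<theta> unfolding equiv_def sym_def trans_def by blast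
    then show ?thesis by (simp add: p_def)
  qed
  have pD: "p a \<in> carrier A" "f (p a) = f a" "(a, p a) \<in> \<sim>\<^sub>I\<^sub>n\<^sub>n\<^bsub>A\<^esub>" if "a \<in> carrier A" for a
    using p[OF that] by (auto simp: \<theta>_def Eq_def)
  \<comment> \<open>This is the congruence property of \<open>\<theta>\<close>: the orbit part is
    \<open>inn_rel_op_cong\<close>, and the kernel part holds because \<open>f\<close> is a
    homomorphism with \<open>f (p a) = f a\<close>.\<close>
  have p_op: "p (p a \<lhd>\<^bsub>A\<^esub> p b) = p (a \<lhd>\<^bsub>A\<^esub> b)" "p (p a \<lhd>\<^sup>-\<^bsub>A\<^esub> p b) = p (a \<lhd>\<^sup>-\<^bsub>A\<^esub> b)"
    if ab: "a \<in> carrier A" "b \<in> carrier A" for a b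
  proof -
    have "(p a \<lhd>\<^bsub>A\<^esub> p b, a \<lhd>\<^bsub>A\<^esub> b) \<in> \<sim>\<^sub>I\<^sub>n\<^sub>n\<^bsub>A\<^esub>" "(p a \<lhd>\<^sup>-\<^bsub>A\<^esub> p b, a \<lhd>\<^sup>-\<^bsub>A\<^esub> b) \<in> \<sim>\<^sub>I\<^sub>n\<^sub>n\<^bsub>A\<^esub>"
      using ab pD rel(2) by (simp_all add: inn_rel_op_cong[OF fD(1)])
    then show "p (p a \<lhd>\<^bsub>A\<^esub> p b) = p (a \<lhd>\<^bsub>A\<^esub> b)" "p (p a \<lhd>\<^sup>-\<^bsub>A\<^esub> p b) = p (a \<lhd>\<^sup>-\<^bsub>A\<^esub> b)"
      using ab by (auto intro!: p_eq simp: \<theta>_def Eq_def pD A.qop_closed A.qinv_closed fD)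
  qed
  \<comment> \<open>Results are computed in \<open>A\<close> and then replaced by their
    representatives; by \<open>p_op\<close> the map \<open>p\<close> carries the operations of
    \<open>A\<close> onto those of \<open>Q\<close>.\<close>
  define Q where "Q = \<lparr>carrier = p ` carrier A, qop = (\<lambda>x y. p (x \<lhd>\<^bsub>A\<^esub> y)),
    qinv = (\<lambda>x y. p (x \<lhd>\<^sup>-\<^bsub>A\<^esub> y))\<rparr>"
  have Q: "quandle Q"
    using quandle_hom_image[of A p Q] by (simp add: Q_def p_op A.quandle_axioms)
  have Q_op: "x \<lhd>\<^bsub>Q\<^esub> y = p (x \<lhd>\<^bsub>A\<^esub> y)" for x y by (simp add: Q_def)
  have QA: "x \<in> carrier A" "p x = x" if "x \<in> carrier Q" for x
    using that pD(1) p_eq[OF p] by (auto simp: Q_def)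
  define e where "e = (\<lambda>a\<in>carrier A. p a)"
  define m where "m = (\<lambda>x\<in>carrier Q. f x)"
  have e: "e \<in> qnd_hom A Q"
    using Q by (intro qnd_homI) (auto simp: e_def Q_def p_op A.qop_closed A.quandle_axioms)
  have m: "m \<in> qnd_hom Q B"
  proof (rule qnd_homI)
    fix x y assume xy: "x \<in> carrier Q" "y \<in> carrier Q"
    have "m (x \<lhd>\<^bsub>Q\<^esub> y) = f (x \<lhd>\<^bsub>Q\<^esub> y)"
      using xy Q by (simp add: m_def quandle.qop_closed)
    also have "\<dots> = f x \<lhd>\<^bsub>B\<^esub> f y"
      using xy[THEN QA(1)] by (simp add: Q_op pD A.qop_closed fD)
    finally show "m (x \<lhd>\<^bsub>Q\<^esub> y) = m x \<lhd>\<^bsub>B\<^esub> m y"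
      using xy by (simp add: m_def)
  qed (use Q QA fD in \<open>auto simp: m_def\<close>)
  \<comment> \<open>On the carrier this is \<open>f (p a) = f a\<close>; elsewhere both sides are
    \<open>undefined\<close>, as \<open>f\<close> is extensional.\<close>
  have eq: "f = compose (carrier A) m e"
    using fD(3) by (auto simp: fun_eq_iff compose_def m_def e_def Q_def pD extensional_def)
  have "e ` carrier A = carrier Q" by (auto simp: e_def Q_def)
  moreover have "Eq A e \<subseteq> \<sim>\<^sub>I\<^sub>n\<^sub>n\<^bsub>A\<^esub>"
  proof clarify
    fix a b assume "(a, b) \<in> Eq A e"
    then have ab: "a \<in> carrier A" "b \<in> carrier A" "p a = p b" by (auto simp: Eq_def e_def)
    then have "(p a, b) \<in> \<sim>\<^sub>I\<^sub>n\<^sub>n\<^bsub>A\<^esub>" using rel(2)[OF pD(3)[of b]] by simp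
    then show "(a, b) \<in> \<sim>\<^sub>I\<^sub>n\<^sub>n\<^bsub>A\<^esub>" using rel(3)[OF pD(3)[OF ab(1)]] by blast
  qed
  moreover have "m ` carrier Q = carrier B"
  proof -
    have "m ` carrier Q = (\<lambda>a. m (p a)) ` carrier A" by (simp add: Q_def image_image)
    also have "\<dots> = f ` carrier A"
      by (rule image_cong) (simp_all add: m_def Q_def pD)
    finally show ?thesis by (simp add: surj)
  qed
  moreover have "Eq Q m \<inter> \<sim>\<^sub>I\<^sub>n\<^sub>n\<^bsub>Q\<^esub> = Id_on (carrier Q)"
  proof
    \<comment> \<open>The orbit relation of \<open>A\<close>, restricted to \<open>Q\<close>,
      contains every step of \<open>Q\<close>: the representative \<open>p (x \<lhd> y)\<close> lies
      in the orbit of \<open>x \<lhd> y\<close>, which is that of \<open>x\<close>. Hence orbits of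
      \<open>Q\<close> stay inside orbits of \<open>A\<close>.\<close>
    let ?S = "{(x, y) \<in> carrier Q \<times> carrier Q. (x, y) \<in> \<sim>\<^sub>I\<^sub>n\<^sub>n\<^bsub>A\<^esub>}"
    have "\<sim>\<^sub>I\<^sub>n\<^sub>n\<^bsub>Q\<^esub> \<subseteq> ?S"
    proof (rule inn_rel_least[OF Q])
      show "equiv (carrier Q) ?S"
        by (intro equivI refl_onI symI transI) (auto intro: rel QA(1))
    next
      fix x y assume xy: "x \<in> carrier Q" "y \<in> carrier Q"
      then have "(x, x \<lhd>\<^bsub>Q\<^esub> y) \<in> \<sim>\<^sub>I\<^sub>n\<^sub>n\<^bsub>A\<^esub>"
        unfolding Q_op using QA(1)
        by (intro rel(3)[OF inn_rel_qop[OF fD(1)] pD(3)] A.qop_closed)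
      with xy Q show "(x, x \<lhd>\<^bsub>Q\<^esub> y) \<in> ?S"
        by (simp add: quandle.qop_closed)
    qed
    then have "x = y" if "(x, y) \<in> Eq Q m" "(x, y) \<in> \<sim>\<^sub>I\<^sub>n\<^sub>n\<^bsub>Q\<^esub>" for x y
    proof -
      from that have xy: "x \<in> carrier Q" "y \<in> carrier Q" "f x = f y"
        by (auto simp: Eq_def m_def)
      \<comment> \<open>Representatives are fixed by \<open>p\<close>, so two
        \<open>\<theta>\<close>-related ones coincide.\<close>
      have "(x, y) \<in> \<theta>"
        using \<open>\<sim>\<^sub>I\<^sub>n\<^sub>n\<^bsub>Q\<^esub> \<subseteq> ?S\<close> that(2) xy QA by (auto simp: \<theta>_def Eq_def)
      then show ?thesis using p_eq QA(2) xy by metis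
    qed
    then show "Eq Q m \<inter> \<sim>\<^sub>I\<^sub>n\<^sub>n\<^bsub>Q\<^esub> \<subseteq> Id_on (carrier Q)" by (auto simp: Id_on_def Eq_def)
    show "Id_on (carrier Q) \<subseteq> Eq Q m \<inter> \<sim>\<^sub>I\<^sub>n\<^sub>n\<^bsub>Q\<^esub>"
      using inn_rel_refl[OF Q] by (auto simp: Eq_def)
  qed
  ultimately show ?thesis using e m eq by blast
qed

text \<open>Once the kernel of \<open>e\<close> lies in that of \<open>u\<close>, \<open>u\<close>
  factors through \<open>e\<close>. Surjectivity of \<open>e\<close> yields the rest: arrows out of
  \<open>B\<close> that agree on all \<open>e a\<close> are equal, which gives both the second
  triangle and uniqueness.\<close>

lemma inn_diagonal:
  assumes e: "e \<in> qnd_hom A B" "e ` carrier A = carrier B" "Eq A e \<subseteq> \<sim>\<^sub>I\<^sub>n\<^sub>n\<^bsub>A\<^esub>"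
    and m: "m \<in> qnd_hom C D" "Eq C m \<inter> \<sim>\<^sub>I\<^sub>n\<^sub>n\<^bsub>C\<^esub> \<subseteq> Id"
    and u: "u \<in> qnd_hom A C" and v: "v \<in> qnd_hom B D"
    and square: "compose (carrier A) v e = compose (carrier A) m u"
  shows "\<exists>!w. w \<in> qnd_hom B C \<and> compose (carrier A) w e = u \<and> compose (carrier B) m w = v"
proof -
  note uD = qnd_homD[OF u] and vD = qnd_homD[OF v]
  have sq: "v (e a) = m (u a)" if "a \<in> carrier A" for a
    using fun_cong[OF square, of a] that by (simp add: compose_def)
  have "Eq A e \<subseteq> Eq A u"
  proof clarify
    fix a a' assume aa': "(a, a') \<in> Eq A e"
    then have carr: "a \<in> carrier A" "a' \<in> carrier A" and "e a = e a'" by (auto simp: Eq_def)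
    then have "(u a, u a') \<in> Eq C m" using sq[of a] sq[of a'] uD by (simp add: Eq_def)
    moreover have "(u a, u a') \<in> \<sim>\<^sub>I\<^sub>n\<^sub>n\<^bsub>C\<^esub>" using e(3) aa' qnd_hom_inn_rel[OF u] by blast
    ultimately show "(a, a') \<in> Eq A u" using m(2) carr by (auto simp: Eq_def)
  qed
  then obtain w where w: "w \<in> qnd_hom B C" "\<And>a. a \<in> carrier A \<Longrightarrow> w (e a) = u a"
    using qnd_hom_factor[OF e(1,2) u] by blast
  show ?thesis
  proof (rule ex1I[of _ w], intro conjI)
    show "w \<in> qnd_hom B C" by (rule w)
    show "compose (carrier A) w e = u"
      using w(2) uD(3) by (auto simp: fun_eq_iff compose_def extensional_def)
    have "m (w b) = v b" if "b \<in> carrier B" for b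
      using that w(2) sq unfolding e(2)[symmetric] by auto
    then show "compose (carrier B) m w = v"
      using vD(3) by (auto simp: fun_eq_iff compose_def extensional_def)
  next
    fix w' assume w': "w' \<in> qnd_hom B C \<and> compose (carrier A) w' e = u \<and>
      compose (carrier B) m w' = v"
    have "w' (e a) = w (e a)" if "a \<in> carrier A" for a
      using w' w(2) that by (auto simp: compose_def)
    then have "w' b = w b" if "b \<in> carrier B" for b
      using that unfolding e(2)[symmetric] by auto
    then show "w' = w"
      using w' w(1) by (auto intro: extensionalityI qnd_homD(3))
  qed
qed

section \<open>Invariance of kernels and orbits under isomorphisms\<close>

lemma qnd_iso_inn_rel:
  assumes i: "i \<in> qnd_iso A B" and a: "a \<in> carrier A" "a' \<in> carrier A"
  shows "(i a, i a') \<in> \<sim>\<^sub>I\<^sub>n\<^sub>n\<^bsub>B\<^esub> \<longleftrightarrow> (a, a') \<in> \<sim>\<^sub>I\<^sub>n\<^sub>n\<^bsub>A\<^esub>"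
proof
  assume rel: "(i a, i a') \<in> \<sim>\<^sub>I\<^sub>n\<^sub>n\<^bsub>B\<^esub>"
  \<comment> \<open>Orbits are reflected because the inverse homomorphism preserves them.\<close>
  obtain g where g: "g \<in> qnd_hom B A" "compose (carrier A) g i = qnd_id A"
    using i by (auto simp: qnd_iso_def)
  have "g (i x) = x" if "x \<in> carrier A" for x
    using fun_cong[OF g(2), of x] that by (simp add: compose_def qnd_id_def)
  then show "(a, a') \<in> \<sim>\<^sub>I\<^sub>n\<^sub>n\<^bsub>A\<^esub>"
    using qnd_hom_inn_rel[OF g(1) rel] a by simp
qed (use i in \<open>auto simp: qnd_iso_iff intro: qnd_hom_inn_rel\<close>)

lemma Eq_compose_iso_right:
  assumes "i \<in> qnd_iso A' A"
  shows "(a, a') \<in> Eq A' (compose (carrier A') f i) \<longleftrightarrow>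
    a \<in> carrier A' \<and> a' \<in> carrier A' \<and> (i a, i a') \<in> Eq A f"
  using assms by (auto simp: Eq_def compose_def qnd_iso_iff dest: qnd_homD(4))

lemma Eq_compose_iso_left:
  assumes "j \<in> qnd_iso B B'" "f \<in> qnd_hom A B"
  shows "Eq A (compose (carrier A) j f) = Eq A f"
  using assms qnd_homD(4)[OF assms(2)]
  by (auto simp: Eq_def compose_def qnd_iso_iff bij_betw_def inj_on_def)

theorem proposition2p11:
  fixes \<F> \<E> \<M> :: "'u quandle \<Rightarrow> 'u quandle \<Rightarrow> ('u \<Rightarrow> 'u) set"
  assumes "\<F> = (\<lambda>A B. {f \<in> qnd_hom A B. f ` carrier A = carrier B})"
    and "\<E> = (\<lambda>A B. {f \<in> \<F> A B. Eq A f \<subseteq> \<sim>\<^sub>I\<^sub>n\<^sub>n\<^bsub>A\<^esub>})"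
    and "\<M> = (\<lambda>A B. {f \<in> \<F> A B. Eq A f \<inter> \<sim>\<^sub>I\<^sub>n\<^sub>n\<^bsub>A\<^esub> = Id_on (carrier A)})"
  shows "factorisation_system \<F> \<E> \<M>"
proof -
  have \<F>: "f \<in> \<F> A B \<longleftrightarrow> f \<in> qnd_hom A B \<and> f ` carrier A = carrier B" for f A B
    by (simp add: assms(1))
  have \<E>: "f \<in> \<E> A B \<longleftrightarrow> f \<in> \<F> A B \<and> Eq A f \<subseteq> \<sim>\<^sub>I\<^sub>n\<^sub>n\<^bsub>A\<^esub>" for f A B
    by (simp add: assms(2))
  have \<M>: "f \<in> \<M> A B \<longleftrightarrow> f \<in> \<F> A B \<and> Eq A f \<inter> \<sim>\<^sub>I\<^sub>n\<^sub>n\<^bsub>A\<^esub> \<subseteq> Id" for f A B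
  proof -
    \<comment> \<open>Both relations are reflexive on the carrier of a quandle, so only one
      inclusion carries information; membership in a hom-set supplies
      \<open>quandle A\<close>.\<close>
    have "Eq A f \<inter> \<sim>\<^sub>I\<^sub>n\<^sub>n\<^bsub>A\<^esub> = Id_on (carrier A) \<longleftrightarrow> Eq A f \<inter> \<sim>\<^sub>I\<^sub>n\<^sub>n\<^bsub>A\<^esub> \<subseteq> Id" if "quandle A"
    proof -
      have "Id_on (carrier A) \<subseteq> Eq A f \<inter> \<sim>\<^sub>I\<^sub>n\<^sub>n\<^bsub>A\<^esub>"
        using inn_rel_refl[OF that] by (auto simp: Eq_def)
      moreover have "Eq A f \<subseteq> carrier A \<times> carrier A" by (auto simp: Eq_def)
      moreover have "Id_on (carrier A) = Id \<inter> carrier A \<times> carrier A" by auto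
      ultimately show ?thesis by blast
    qed
    then show ?thesis
      using qnd_homD(1)[of f A B] unfolding assms(1,3) by blast
  qed
  have \<F>_compose: "compose (carrier A) g f \<in> \<F> A C"
    if "f \<in> \<F> A B" "g \<in> \<F> B C" for f g A B C
    using that by (auto simp: \<F> compose_qnd_hom surj_compose)
  have iso_\<F>: "i \<in> \<F> A B" if "i \<in> qnd_iso A B" for i A B
    using that by (simp add: \<F> qnd_iso_iff bij_betw_def)
  have "is_qnd_class \<F>" "is_qnd_class \<E>" "is_qnd_class \<M>"
    by (auto simp: is_qnd_class_def \<F> \<E> \<M>)
  moreover have "contains_identities \<E>" "contains_identities \<M>"
    using qnd_id_hom inn_rel_refl
    by (fastforce simp: contains_identities_def \<F> \<E> \<M> qnd_id_def Eq_def)+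
  moreover have "closed_under_isos \<E>"
    unfolding closed_under_isos_def
  proof (intro allI ballI conjI)
    fix A B f A' i assume f: "f \<in> \<E> A B" and i: "i \<in> qnd_iso A' A"
    have "compose (carrier A') f i \<in> \<F> A' B"
      using f by (intro \<F>_compose[OF iso_\<F>[OF i]]) (simp add: \<E>)
    then show "compose (carrier A') f i \<in> \<E> A' B"
      using f i qnd_iso_inn_rel[OF i] by (auto simp: \<E> Eq_compose_iso_right)
  next
    fix A B f B' j assume f: "f \<in> \<E> A B" and j: "j \<in> qnd_iso B B'"
    have "compose (carrier A) j f \<in> \<F> A B'"
      using f by (intro \<F>_compose[OF _ iso_\<F>[OF j]]) (simp add: \<E>)
    then show "compose (carrier A) j f \<in> \<E> A B'"
      \<comment> \<open>The condition concerns only the kernel and the orbits of the domain, and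
        composing with the injective \<open>j\<close> afterwards changes neither.\<close>
      using f j by (auto simp: \<E> \<F> Eq_compose_iso_left)
  qed
  moreover have "closed_under_isos \<M>"
    unfolding closed_under_isos_def
  proof (intro allI ballI conjI)
    fix A B f A' i assume f: "f \<in> \<M> A B" and i: "i \<in> qnd_iso A' A"
    have "compose (carrier A') f i \<in> \<F> A' B"
      using f by (intro \<F>_compose[OF iso_\<F>[OF i]]) (simp add: \<M>)
    moreover have "a = a'"
      if "(a, a') \<in> Eq A' (compose (carrier A') f i)" "(a, a') \<in> \<sim>\<^sub>I\<^sub>n\<^sub>n\<^bsub>A'\<^esub>" for a a'
    proof -
      have a: "a \<in> carrier A'" "a' \<in> carrier A'" "(i a, i a') \<in> Eq A f"
        using that(1) Eq_compose_iso_right[OF i] by blast+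
      \<comment> \<open>The pair of images lies in the kernel of \<open>f\<close> and in one orbit
        of \<open>A\<close>, so \<open>f \<in> \<M> A B\<close> forces equality; injectivity of
        \<open>i\<close> then gives \<open>a = a'\<close>.\<close>
      then have "i a = i a'"
        using f that(2) qnd_iso_inn_rel[OF i] by (auto simp: \<M>)
      with a i show ?thesis by (auto simp: qnd_iso_iff bij_betw_def inj_on_def)
    qed
    ultimately show "compose (carrier A') f i \<in> \<M> A' B" by (auto simp: \<M>)
  next
    fix A B f B' j assume f: "f \<in> \<M> A B" and j: "j \<in> qnd_iso B B'"
    have "compose (carrier A) j f \<in> \<F> A B'"
      using f by (intro \<F>_compose[OF _ iso_\<F>[OF j]]) (simp add: \<M>)
    then show "compose (carrier A) j f \<in> \<M> A B'"
      using f j by (auto simp: \<M> \<F> Eq_compose_iso_left)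
  qed
  moreover have "\<forall>A B. \<forall>f \<in> \<F> A B. \<exists>C. \<exists>e \<in> \<E> A C. \<exists>m \<in> \<M> C B. f = compose (carrier A) m e"
  proof (intro allI ballI)
    fix A B f assume "f \<in> \<F> A B"
    then obtain Q e m where "e \<in> qnd_hom A Q" "m \<in> qnd_hom Q B"
      "e ` carrier A = carrier Q" "Eq A e \<subseteq> \<sim>\<^sub>I\<^sub>n\<^sub>n\<^bsub>A\<^esub>"
      "m ` carrier Q = carrier B" "Eq Q m \<inter> \<sim>\<^sub>I\<^sub>n\<^sub>n\<^bsub>Q\<^esub> = Id_on (carrier Q)"
      and f: "f = compose (carrier A) m e"
      using inn_factorisation[of f A B] by (auto simp: \<F>)
    then have "e \<in> \<E> A Q" "m \<in> \<M> Q B" by (auto simp: \<E> \<M> \<F>)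
    with f show "\<exists>C. \<exists>e \<in> \<E> A C. \<exists>m \<in> \<M> C B. f = compose (carrier A) m e" by blast
  qed
  moreover have "\<forall>A B C D. \<forall>e \<in> \<E> A B. \<forall>m \<in> \<M> C D. \<forall>u \<in> qnd_hom A C. \<forall>v \<in> qnd_hom B D.
      compose (carrier A) v e = compose (carrier A) m u \<longrightarrow>
      (\<exists>!w. w \<in> qnd_hom B C \<and> compose (carrier A) w e = u \<and> compose (carrier B) m w = v)"
    by (intro allI ballI impI, rule inn_diagonal) (simp_all add: \<E> \<M> \<F>)
  ultimately show ?thesis
    by (simp add: factorisation_system_def)
qed

end
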